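(* Let $F_0=0$, $F_1=1$, $F_{n+2}=F_{n+1}+F_n$ be the Fibonacci numbers and suppose the move costs are $w_{n,k}=\alpha_n=F_{n+1}$ for all $n\in\mathbb{N}_0$ and all $k\in T=\{0,1,2\}$. Let $t_n$ denote the common value $d_{n,0}=d_{n,1}=d_{n,2}$ of the minimal costs. Then for all $n\in\mathbb{N}_0$, $$t_n=2^{n+1}-F_{n+3}.$$ Moreover, $(t_n)$ satisfies the order-$3$ recurrence $$t_0=0,\ t_1=1,\ t_2=3,\qquad t_{n+3}=3t_{n+2}-t_{n+1}-2t_n\quad(n\in\mathbb{N}_0).$$
   Context: Weighted Tower of Hanoi: $\mathbb{N}_0$ denotes the nonnegative integers; $T=\{0,1,2\}$ is the set of pegs; discs are labelled $1,2,3,\dots$ by increasing size. A state with $n$ discs is an assignment of the discs $1,\dots,n$ to the pegs, the discs on each peg being stacked with smaller discs above larger ones. A legal move transfers the topmost (smallest) disc of one peg to a different peg carrying no smaller disc. For $i\in T$, $i^n$ is the perfect state with all $n$ discs on peg $i$. For $\{i,j,k\}=T$ and $n\in\mathbb{N}_0$, $w_{n,k}\in[0,\infty)$ is a given cost of a single move of disc $n+1$ between pegs $i$ and $j$ (in either direction), and $d_{n,k}$ is the minimal total cost, over all finite sequences of legal moves, of getting from $i^n$ to $j^n$ with $n$ discs. When the costs do not depend on $k$, the values $d_{n,0},d_{n,1},d_{n,2}$ coincide. *)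

theory Defs
  imports Complex_Main "HOL-Library.FuncSet" "HOL-Number_Theory.Fib"
begin

definition pegs :: "nat set" where
  "pegs = {0, 1, 2}"

text \<open>A state only records the peg of each disc: as the discs on a peg are always stacked by size,
  the topmost disc of a peg is the smallest disc on it.\<close>

definition states :: "nat \<Rightarrow> (nat \<Rightarrow> nat) set" where
  "states n = {1..n} \<rightarrow>\<^sub>E pegs"

definition perfect :: "nat \<Rightarrow> nat \<Rightarrow> (nat \<Rightarrow> nat)" where
  "perfect n i = (\<lambda>d\<in>{1..n}. i)"

text \<open>In state \<open>s\<close>, disc \<open>d\<close> is the smallest one on its peg and may go to the different peg \<open>b\<close>,
  which carries no smaller disc.\<close>

definition legal_move :: "nat \<Rightarrow> (nat \<Rightarrow> nat) \<Rightarrow> nat \<Rightarrow> nat \<Rightarrow> bool" where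
  "legal_move n s d b \<longleftrightarrow>
     s \<in> states n \<and> d \<in> {1..n} \<and> b \<in> pegs \<and> b \<noteq> s d \<and>
     (\<forall>e\<in>{1..<d}. s e \<noteq> s d \<and> s e \<noteq> b)"

text \<open>\<open>transfer w n s c s'\<close>: some finite sequence of legal moves of total cost \<open>c\<close> leads from \<open>s\<close>
  to \<open>s'\<close>. The cost of a single move of disc \<open>m + 1\<close> is \<open>w m k\<close>, where \<open>k\<close> is the peg
  not involved in the move.\<close>

inductive transfer ::
    "(nat \<Rightarrow> nat \<Rightarrow> real) \<Rightarrow> nat \<Rightarrow> (nat \<Rightarrow> nat) \<Rightarrow> real \<Rightarrow> (nat \<Rightarrow> nat) \<Rightarrow> bool"
  for w :: "nat \<Rightarrow> nat \<Rightarrow> real" and n :: nat where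
  refl: "s \<in> states n \<Longrightarrow> transfer w n s 0 s"
| step: "\<lbrakk>legal_move n s d b; {s d, b, k} = pegs; transfer w n (s(d := b)) c s'\<rbrakk>
         \<Longrightarrow> transfer w n s (w (d - 1) k + c) s'"

definition min_cost :: "(nat \<Rightarrow> nat \<Rightarrow> real) \<Rightarrow> nat \<Rightarrow> nat \<Rightarrow> nat \<Rightarrow> real" where
  "min_cost w n i j = (LEAST c. transfer w n (perfect n i) c (perfect n j))"

text \<open>For a peg \<open>k\<close>, the other two pegs are \<open>k + 1\<close> and \<open>k + 2\<close> modulo 3; in which order they are
  used is irrelevant by \<open>min_cost_eq_hanoi_cost\<close> below.\<close>

definition hanoi_cost :: "(nat \<Rightarrow> nat \<Rightarrow> real) \<Rightarrow> nat \<Rightarrow> nat \<Rightarrow> real" where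
  "hanoi_cost w n k = min_cost w n ((k + 1) mod 3) ((k + 2) mod 3)"

lemma transfer_states:
  assumes "transfer w n s c s'"
  shows "s \<in> states n" "s' \<in> states n"
  using assms by (induction) (auto simp: legal_move_def)

lemma transfer_trans:
  assumes "transfer w n s c s'" "transfer w n s' c' s''"
  shows "transfer w n s (c + c') s''"
  using assms
proof induction
  case (step s d b k c s')
  show ?case
    using transfer.step[OF step.hyps(1,2) step.IH[OF step.prems]] by (simp add: add.assoc)
qed simp

lemma legal_move_result:
  assumes "legal_move n s d b"
  shows "s(d := b) \<in> states n"
  using assms unfolding legal_move_def states_def
  by (auto simp: PiE_iff extensional_def)

lemma legal_move_reverse:
  assumes "legal_move n s d b"
  shows "legal_move n (s(d := b)) d (s d)"
  using assms legal_move_result[OF assms] unfolding legal_move_def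
  by (auto simp: states_def PiE_iff)

lemma transfer_reverse:
  assumes "transfer w n s c s'"
  shows "transfer w n s' c s"
  using assms
proof induction
  case (refl s)
  then show ?case by (rule transfer.refl)
next
  case (step s d b k c s')
  have s: "s \<in> states n" using step.hyps(1) by (simp add: legal_move_def)
  have "transfer w n (s(d := b)) (w (d - 1) k + 0) s"
  proof (rule transfer.step[OF legal_move_reverse[OF step.hyps(1)]])
    show "{(s(d := b)) d, s d, k} = pegs" using step.hyps(2) by (simp add: insert_commute)
    show "transfer w n ((s(d := b))(d := s d)) 0 s" using s by (simp add: transfer.refl)
  qed
  with step.IH have "transfer w n s' (c + (w (d - 1) k + 0)) s"
    by (rule transfer_trans)
  then show ?case by (simp add: add.commute)
qed

lemma min_cost_commute: "min_cost w n i j = min_cost w n j i"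
  unfolding min_cost_def by (metis transfer_reverse)

lemma min_cost_eq_hanoi_cost:
  assumes "{i, j, k} = pegs"
  shows "min_cost w n i j = hanoi_cost w n k"
proof -
  have "i \<in> pegs" "j \<in> pegs" "k \<in> pegs"
    unfolding assms[symmetric] by simp_all
  moreover have "card {i, j, k} = 3"
    unfolding assms by (simp add: pegs_def)
  then have "i \<noteq> j" "i \<noteq> k" "j \<noteq> k"
    by (auto simp: card_insert_if split: if_splits)
  ultimately have "(k + 1) mod 3 = i \<and> (k + 2) mod 3 = j \<or> (k + 1) mod 3 = j \<and> (k + 2) mod 3 = i"
    unfolding pegs_def by (elim insertE emptyE) simp_all
  then show ?thesis
  proof
    assume "(k + 1) mod 3 = i \<and> (k + 2) mod 3 = j"
    then show ?thesis by (simp add: hanoi_cost_def)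
  next
    assume "(k + 1) mod 3 = j \<and> (k + 2) mod 3 = i"
    then show ?thesis by (simp add: hanoi_cost_def min_cost_commute[of w n i j])
  qed
qed

text \<open>The remaining lemmas show that the \<open>LEAST\<close> in \<open>min_cost\<close> exists for all nonnegative costs.\<close>

lemma third_peg:
  assumes "a \<in> pegs" "b \<in> pegs" "a \<noteq> b"
  shows "\<exists>k\<in>pegs. k \<noteq> a \<and> k \<noteq> b \<and> {a, b, k} = pegs"
proof -
  have "{a, b, 3 - a - b} = pegs \<and> 3 - a - b \<in> pegs \<and> 3 - a - b \<noteq> a \<and> 3 - a - b \<noteq> b"
    using assms unfolding pegs_def by (elim insertE emptyE) (simp_all add: insert_commute)
  then show ?thesis by blast
qed

lemma transfer_exists_upto:
  assumes "m \<le> n" "s \<in> states n" "s' \<in> states n" "\<And>d. d > m \<Longrightarrow> s d = s' d"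
  shows "\<exists>c. transfer w n s c s'"
  using assms
proof (induction m arbitrary: s s')
  case 0
  have "s d = s' d" for d
    using 0 by (cases "d = 0") (auto simp: states_def PiE_iff extensional_def)
  then have "s = s'" by blast
  with 0 show ?case by (auto intro: transfer.refl)
next
  case (Suc m)
  show ?case
  proof (cases "s (Suc m) = s' (Suc m)")
    case True
    then have "s d = s' d" if "d > m" for d
      using that Suc.prems(4) by (cases "d = Suc m") auto
    then show ?thesis using Suc by auto
  next
    case False
    have pegs: "s (Suc m) \<in> pegs" "s' (Suc m) \<in> pegs"
      using Suc.prems by (auto simp: states_def PiE_iff)
    obtain k where k: "k \<in> pegs" "k \<noteq> s (Suc m)" "k \<noteq> s' (Suc m)"
        "{s (Suc m), s' (Suc m), k} = pegs"
      using third_peg[OF pegs False] by blast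
    define u where "u = (\<lambda>d. if d \<in> {1..m} then k else s d)"
    have u: "u \<in> states n"
      using Suc.prems k(1) by (auto simp: u_def states_def PiE_iff extensional_def)
    have uS: "u (Suc m) = s (Suc m)" by (simp add: u_def)
    have legal: "legal_move n u (Suc m) (s' (Suc m))"
      using u k Suc.prems(1) False pegs by (auto simp: legal_move_def u_def)
    define v where "v = u(Suc m := s' (Suc m))"
    have v: "v \<in> states n" using legal_move_result[OF legal] by (simp add: v_def)
    obtain c where c: "transfer w n s c u"
      using Suc.IH[of s u] Suc.prems u by (auto simp: u_def)
    have "v d = s' d" if "d > m" for d
      using that Suc.prems(4) by (cases "d = Suc m") (auto simp: v_def u_def)
    then obtain c' where c': "transfer w n v c' s'"
      using Suc.IH[of v s'] Suc.prems v by auto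
    have "transfer w n u (w (Suc m - 1) k + c') s'"
      by (rule transfer.step[OF legal]) (use k(4) c' in \<open>simp_all add: uS v_def\<close>)
    with c show ?thesis by (blast intro: transfer_trans)
  qed
qed

lemma transfer_exists:
  assumes "s \<in> states n" "s' \<in> states n"
  shows "\<exists>c. transfer w n s c s'"
proof (rule transfer_exists_upto[OF order.refl assms])
  fix d assume "d > n"
  then show "s d = s' d" using assms by (auto simp: states_def PiE_iff extensional_def)
qed

lemma finite_bounded_sums:
  fixes W :: "real set"
  assumes "finite W" "\<And>x. x \<in> W \<Longrightarrow> 0 \<le> x"
  shows "finite {c. c \<le> B \<and> (\<exists>xs. set xs \<subseteq> W \<and> c = sum_list xs)}" (is "finite ?S")
proof -
  define P where "P = {x \<in> W. 0 < x}"
  have fP: "finite P" using assms by (simp add: P_def)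
  define \<epsilon> where "\<epsilon> = Min (insert 1 P)"
  have \<epsilon>: "0 < \<epsilon>" "\<And>x. x \<in> P \<Longrightarrow> \<epsilon> \<le> x"
    using fP by (auto simp: \<epsilon>_def P_def)
  have len: "real (length ys) * \<epsilon> \<le> sum_list ys" if "set ys \<subseteq> P" for ys
    using that
  proof (induction ys)
    case (Cons y ys)
    then have "real (length ys) * \<epsilon> \<le> sum_list ys" "\<epsilon> \<le> y" using \<epsilon>(2) by auto
    then show ?case by (simp add: distrib_right)
  qed simp
  have "?S \<subseteq> sum_list ` {ys. set ys \<subseteq> P \<and> length ys \<le> nat \<lfloor>B / \<epsilon>\<rfloor>}"
  proof
    fix c assume "c \<in> ?S"
    then obtain xs where xs: "c \<le> B" "set xs \<subseteq> W" "c = sum_list xs" by blast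
    define ys where "ys = filter (\<lambda>x. 0 < x) xs"
    have ys: "set ys \<subseteq> P" using xs(2) by (auto simp: ys_def P_def)
    have "sum_list xs = sum_list ys"
      unfolding ys_def using xs(2)
    proof (induction xs)
      case (Cons x xs)
      then show ?case using assms(2)[of x] by auto
    qed simp
    then have c: "c = sum_list ys" using xs(3) by simp
    then have "real (length ys) * \<epsilon> \<le> B" using len[OF ys] xs(1) by linarith
    then have "real (length ys) \<le> B / \<epsilon>" using \<epsilon>(1) by (simp add: pos_le_divide_eq)
    then have "int (length ys) \<le> \<lfloor>B / \<epsilon>\<rfloor>" by (simp add: le_floor_iff)
    then have "length ys \<le> nat \<lfloor>B / \<epsilon>\<rfloor>" by linarith
    with ys c show "c \<in> sum_list ` {ys. set ys \<subseteq> P \<and> length ys \<le> nat \<lfloor>B / \<epsilon>\<rfloor>}" by blast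
  qed
  then show ?thesis using finite_lists_length_le[OF fP] finite_surj by blast
qed

lemma transfer_cost_sum:
  assumes "transfer w n s c s'"
  shows "\<exists>xs. set xs \<subseteq> (\<lambda>(m, k). w m k) ` ({..<n} \<times> pegs) \<and> c = sum_list xs"
  using assms
proof induction
  case (refl s)
  show ?case by (rule exI[of _ "[]"]) simp
next
  case (step s d b k c s')
  then obtain xs where xs: "set xs \<subseteq> (\<lambda>(m, k). w m k) ` ({..<n} \<times> pegs)" "c = sum_list xs"
    by blast
  have "d - 1 < n" "k \<in> pegs" using step.hyps(1,2) by (auto simp: legal_move_def)
  then have "w (d - 1) k \<in> (\<lambda>(m, k). w m k) ` ({..<n} \<times> pegs)" by force
  with xs show ?case by (intro exI[of _ "w (d - 1) k # xs"]) simp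
qed

lemma min_cost_is_minimum:
  assumes "\<And>m k. k \<in> pegs \<Longrightarrow> 0 \<le> w m k" "i \<in> pegs" "j \<in> pegs"
  shows "transfer w n (perfect n i) (min_cost w n i j) (perfect n j)"
    and "transfer w n (perfect n i) c (perfect n j) \<Longrightarrow> min_cost w n i j \<le> c"
proof -
  let ?T = "\<lambda>c. transfer w n (perfect n i) c (perfect n j)"
  let ?W = "(\<lambda>(m, k). w m k) ` ({..<n} \<times> pegs)"
  have "perfect n i \<in> states n" "perfect n j \<in> states n"
    using assms by (auto simp: perfect_def states_def)
  then obtain B where B: "?T B" using transfer_exists by blast
  define C where "C = {c. c \<le> B \<and> ?T c}"
  have "finite ?W" "\<And>x. x \<in> ?W \<Longrightarrow> 0 \<le> x" using assms(1) by (auto simp: pegs_def)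
  then have "finite {c. c \<le> B \<and> (\<exists>xs. set xs \<subseteq> ?W \<and> c = sum_list xs)}"
    by (rule finite_bounded_sums)
  moreover have "C \<subseteq> {c. c \<le> B \<and> (\<exists>xs. set xs \<subseteq> ?W \<and> c = sum_list xs)}"
    unfolding C_def using transfer_cost_sum by blast
  ultimately have fin: "finite C" using finite_subset by blast
  have ne: "C \<noteq> {}" using B by (auto simp: C_def)
  have T: "?T (Min C)" and "Min C \<le> B" using Min_in[OF fin ne] by (auto simp: C_def)
  have le: "Min C \<le> c" if "?T c" for c
    using that Min_le[OF fin, of c] \<open>Min C \<le> B\<close> by (cases "c \<le> B") (auto simp: C_def)
  have "min_cost w n i j = Min C"
    unfolding min_cost_def using T le by (rule Least_equality)
  with T le show "?T (min_cost w n i j)" "?T c \<Longrightarrow> min_cost w n i j \<le> c" by auto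
qed

end

theory Submission
  imports Defs
begin

text \<open>
  The classical recursive solution moves the \<open>n\<close> smaller discs out of the way, moves disc \<open>n + 1\<close>
  once, and puts the smaller discs back on top of it. If the cost \<open>\<alpha> n\<close> of moving disc \<open>n + 1\<close>
  does not depend on the pegs, nothing is cheaper. Indeed, any solution has to gather the
  smaller discs on a single other peg before the first move of the largest disc, and has to bring
  them from a single other peg to the goal after its last move. Each of these two phases is a
  transfer of the smaller tower between different pegs, and between them at least one move of the
  largest disc takes place (\<open>transfer_Suc_decompose\<close>). Hence the minimal costs satisfy
  \<open>t (n + 1) = 2 * t n + \<alpha> n\<close> with \<open>t 0 = 0\<close> for all pairs of pegs.

  For \<open>\<alpha> n = F (n + 1)\<close>, the homogeneous part of this recursion contributes \<open>2 ^ (n + 1)\<close>, and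
  \<open>- F (n + 3)\<close> is a particular solution because \<open>F (n + 4) = 2 * F (n + 3) - F (n + 1)\<close>. The
  recurrence of order 3 has the characteristic polynomial \<open>(x - 2) * (x\<^sup>2 - x - 1)\<close>, whose factors
  annihilate the two summands.
\<close>

lemma perfect_in_states: "i \<in> pegs \<Longrightarrow> perfect n i \<in> states n"
  by (auto simp: perfect_def states_def)

lemma restrict_perfect_Suc: "restrict (perfect (Suc n) i) {1..n} = perfect n i"
  by (auto simp: perfect_def restrict_def fun_eq_iff)

lemma perfect_Suc: "perfect (Suc n) i = (perfect n i)(Suc n := i)"
  by (auto simp: perfect_def restrict_def fun_eq_iff)

lemma transfer_cost_nonneg:
  assumes "transfer w n s c s'" and "\<And>m k. k \<in> pegs \<Longrightarrow> 0 \<le> w m k"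
  shows "0 \<le> c"
  using assms(1)
proof induction
  case (step s d b k c s')
  then have "k \<in> pegs" by blast
  with assms(2) step.IH show ?case by simp
qed simp

text \<open>The largest disc never obstructs a smaller one, so it may rest on any peg.\<close>

lemma transfer_add_largest:
  assumes "transfer w n s c s'" and "p \<in> pegs"
  shows "transfer w (Suc n) (s(Suc n := p)) c (s'(Suc n := p))"
  using assms(1)
proof induction
  case (refl s)
  with assms(2) show ?case
    by (auto intro!: transfer.refl simp: states_def PiE_iff extensional_def)
next
  case (step s d b k c s')
  have d: "d \<noteq> Suc n" using step.hyps(1) by (auto simp: legal_move_def)
  then have twist: "(s(Suc n := p))(d := b) = (s(d := b))(Suc n := p)"
    by (rule fun_upd_twist[symmetric])
  have "legal_move (Suc n) (s(Suc n := p)) d b"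
    using step.hyps(1) assms(2)
    by (auto simp: legal_move_def states_def PiE_iff extensional_def)
  then show ?case
    by (rule transfer.step) (use step d in \<open>simp_all only: twist fun_upd_other not_False_eq_True\<close>)
qed

lemma legal_move_restrict:
  assumes "legal_move (Suc n) s d b" and "d \<noteq> Suc n"
  shows "legal_move n (restrict s {1..n}) d b"
  using assms by (auto simp: legal_move_def states_def PiE_iff)

text \<open>When the largest disc moves, all smaller discs avoid both pegs involved, so that they form
  a perfect tower on the remaining one.\<close>

lemma legal_move_largest:
  assumes "legal_move (Suc n) s (Suc n) b" and "{s (Suc n), b, k} = pegs"
  shows "restrict s {1..n} = perfect n k"
proof
  fix e
  have "s e = k" if "e \<in> {1..n}"
  proof -
    have "s e \<in> pegs" "s e \<noteq> s (Suc n)" "s e \<noteq> b"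
      using assms(1) that by (auto simp: legal_move_def states_def PiE_iff)
    then show ?thesis unfolding assms(2)[symmetric] by simp
  qed
  then show "restrict s {1..n} e = perfect n k e" by (auto simp: perfect_def)
qed

lemma third_peg_distinct:
  assumes "{a, b, k} = pegs"
  shows "k \<in> pegs" "k \<noteq> a" "k \<noteq> b"
proof -
  show "k \<in> pegs" using assms by blast
  have "card {a, b, k} = 3" unfolding assms by (simp add: pegs_def)
  then show "k \<noteq> a" "k \<noteq> b" by (auto simp: card_insert_if split: if_splits)
qed

text \<open>The heart of the lower bound. Either the largest disc rests throughout, or a sequence of
  moves is cut at its first and at its last move of the largest disc. At these moments the smaller
  discs are gathered on pegs \<open>p\<close> and \<open>q\<close>. From the cost of everything in between, only the lower
  bound \<open>a\<close> for a single move of the largest disc is retained.\<close>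

lemma transfer_Suc_decompose:
  assumes "transfer w (Suc n) s c s'"
    and nonneg: "\<And>m k. k \<in> pegs \<Longrightarrow> 0 \<le> w m k"
    and a: "\<And>k. k \<in> pegs \<Longrightarrow> a \<le> w n k" "0 \<le> a"
  shows "s (Suc n) = s' (Suc n) \<and> transfer w n (restrict s {1..n}) c (restrict s' {1..n}) \<or>
    (\<exists>p\<in>pegs. \<exists>q\<in>pegs. \<exists>c1 c2. p \<noteq> s (Suc n) \<and> q \<noteq> s' (Suc n) \<and>
       transfer w n (restrict s {1..n}) c1 (perfect n p) \<and>
       transfer w n (perfect n q) c2 (restrict s' {1..n}) \<and> c1 + a + c2 \<le> c)"
    (is "?rest s c s' \<or> ?moved s c s'")
  using assms(1)
proof induction
  case (refl s)
  then have "restrict s {1..n} \<in> states n" by (auto simp: states_def PiE_iff)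
  then show ?case by (intro disjI1 conjI transfer.refl HOL.refl)
next
  case (step s d b k c s')
  note k = third_peg_distinct[OF step.hyps(2)]
  show ?case
  proof (cases "d = Suc n")
    case False
    then have "d \<in> {1..n}" using step.hyps(1) by (auto simp: legal_move_def)
    then have upd: "restrict (s(d := b)) {1..n} = (restrict s {1..n})(d := b)"
      by (auto simp: fun_eq_iff)
    have prepend: "transfer w n (restrict s {1..n}) (w (d - 1) k + c') u"
      if "transfer w n (restrict (s(d := b)) {1..n}) c' u" for c' u
      by (rule transfer.step[OF legal_move_restrict[OF step.hyps(1) False]])
        (use that step.hyps(2) \<open>d \<in> {1..n}\<close> in \<open>simp_all add: upd del: One_nat_def\<close>)
    have largest: "(s(d := b)) (Suc n) = s (Suc n)" using False by simp
    from step.IH show ?thesis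
    proof
      assume "?rest (s(d := b)) c s'"
      with prepend show ?thesis unfolding largest by blast
    next
      assume "?moved (s(d := b)) c s'"
      then obtain p q c1 c2 where pq: "p \<in> pegs" "q \<in> pegs" "p \<noteq> s (Suc n)" "q \<noteq> s' (Suc n)"
          "transfer w n (restrict (s(d := b)) {1..n}) c1 (perfect n p)"
          "transfer w n (perfect n q) c2 (restrict s' {1..n})" "c1 + a + c2 \<le> c"
        unfolding largest by blast
      have "w (d - 1) k + c1 + a + c2 \<le> w (d - 1) k + c" using pq(7) by simp
      with pq prepend[OF pq(5)] show ?thesis by blast
    qed
  next
    case True
    have perf: "restrict s {1..n} = perfect n k"
      using legal_move_largest step.hyps(1,2) True by blast
    then have stay: "transfer w n (restrict s {1..n}) 0 (perfect n k)"
      using k(1) by (simp add: transfer.refl perfect_in_states)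
    have upd: "restrict (s(d := b)) {1..n} = restrict s {1..n}"
      using True by (auto simp: fun_eq_iff)
    have k': "k \<noteq> s (Suc n)" using k(2) True by simp
    have w: "a \<le> w (d - 1) k" using a(1)[OF k(1)] True by simp
    from step.IH have "?moved s (w (d - 1) k + c) s'"
    proof
      assume "?rest (s(d := b)) c s'"
      then have "k \<noteq> s' (Suc n)" "transfer w n (perfect n k) c (restrict s' {1..n})"
        using k(3) unfolding True[symmetric] upd perf fun_upd_same by blast+
      moreover have "0 + a + c \<le> w (d - 1) k + c" using w by simp
      ultimately show ?thesis using k(1) k' stay by blast
    next
      assume "?moved (s(d := b)) c s'"
      \<comment> \<open>Of the remaining sequence, only the phase after its last move of disc \<open>n + 1\<close> counts.\<close>
      then obtain q c1 c2 p where q: "q \<in> pegs" "q \<noteq> s' (Suc n)"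
          "transfer w n (restrict (s(d := b)) {1..n}) c1 (perfect n p)"
          "transfer w n (perfect n q) c2 (restrict s' {1..n})" "c1 + a + c2 \<le> c"
        by blast
      have "0 \<le> c1" using transfer_cost_nonneg[OF q(3)] nonneg by blast
      then have "0 + a + c2 \<le> w (d - 1) k + c" using q(5) w a(2) by linarith
      then show ?thesis using k(1) k' stay q(1,2,4) by blast
    qed
    then show ?thesis ..
  qed
qed

primrec tower_cost :: "(nat \<Rightarrow> real) \<Rightarrow> nat \<Rightarrow> real" where
  "tower_cost \<alpha> 0 = 0"
| "tower_cost \<alpha> (Suc n) = 2 * tower_cost \<alpha> n + \<alpha> n"

lemma transfer_tower_cost:
  assumes "\<And>m k. k \<in> pegs \<Longrightarrow> w m k = \<alpha> m"
    and "i \<in> pegs" "j \<in> pegs" "i \<noteq> j"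
  shows "transfer w n (perfect n i) (tower_cost \<alpha> n) (perfect n j)"
  using assms(2-)
proof (induction n arbitrary: i j)
  case 0
  have "perfect 0 i = perfect 0 j" by (simp add: perfect_def fun_eq_iff)
  with 0 show ?case by (simp add: transfer.refl perfect_in_states)
next
  case (Suc n)
  obtain k where k: "k \<in> pegs" "k \<noteq> i" "k \<noteq> j" "{i, j, k} = pegs"
    using third_peg[OF Suc.prems] by blast
  let ?u = "(perfect n k)(Suc n := i)"
  have unstack: "transfer w (Suc n) (perfect (Suc n) i) (tower_cost \<alpha> n) ?u"
    unfolding perfect_Suc using Suc k by (intro transfer_add_largest) auto
  have restack: "transfer w (Suc n) (?u(Suc n := j)) (tower_cost \<alpha> n) (perfect (Suc n) j)"
    unfolding perfect_Suc fun_upd_upd using Suc k by (intro transfer_add_largest) auto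
  have "legal_move (Suc n) ?u (Suc n) j"
    using transfer_states(2)[OF unstack] Suc.prems k by (auto simp: legal_move_def perfect_def)
  then have "transfer w (Suc n) ?u (w (Suc n - 1) k + tower_cost \<alpha> n) (perfect (Suc n) j)"
    by (rule transfer.step) (use k restack in simp_all)
  from transfer_trans[OF unstack this] show ?case
    using assms(1)[OF k(1)] by (simp add: algebra_simps)
qed

lemma tower_cost_le:
  assumes w: "\<And>m k. k \<in> pegs \<Longrightarrow> w m k = \<alpha> m" and nonneg: "\<And>m. 0 \<le> \<alpha> m"
    and "transfer w n (perfect n i) c (perfect n j)" "i \<in> pegs" "j \<in> pegs" "i \<noteq> j"
  shows "tower_cost \<alpha> n \<le> c"
  using assms(3-)
proof (induction n arbitrary: i j c)
  case 0
  have "0 \<le> c" by (rule transfer_cost_nonneg[OF "0.prems"(1)]) (simp add: w nonneg)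
  then show ?case by simp
next
  case (Suc n)
  have top: "perfect (Suc n) l (Suc n) = l" for l by (simp add: perfect_def)
  have "(\<exists>p\<in>pegs. \<exists>q\<in>pegs. \<exists>c1 c2. p \<noteq> i \<and> q \<noteq> j \<and>
       transfer w n (perfect n i) c1 (perfect n p) \<and>
       transfer w n (perfect n q) c2 (perfect n j) \<and> c1 + \<alpha> n + c2 \<le> c)"
    using transfer_Suc_decompose[OF Suc.prems(1), of "\<alpha> n"] Suc.prems(4)
    by (simp add: w nonneg top restrict_perfect_Suc del: One_nat_def)
  then obtain p q c1 c2 where pq: "p \<in> pegs" "q \<in> pegs" "p \<noteq> i" "q \<noteq> j"
      "transfer w n (perfect n i) c1 (perfect n p)"
      "transfer w n (perfect n q) c2 (perfect n j)" "c1 + \<alpha> n + c2 \<le> c"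
    by blast
  have "tower_cost \<alpha> n \<le> c1" using Suc.IH[OF pq(5)] Suc.prems pq by auto
  moreover have "tower_cost \<alpha> n \<le> c2" using Suc.IH[OF pq(6)] Suc.prems pq by auto
  ultimately show ?case using pq(7) by simp
qed

theorem hanoi_cost_peg_independent:
  assumes "\<And>m k. k \<in> pegs \<Longrightarrow> w m k = \<alpha> m" and "\<And>m. 0 \<le> \<alpha> m"
    and "k \<in> pegs"
  shows "hanoi_cost w n k = tower_cost \<alpha> n"
proof -
  let ?i = "(k + 1) mod 3" and ?j = "(k + 2) mod 3"
  have ij: "?i \<in> pegs" "?j \<in> pegs" "?i \<noteq> ?j"
    using assms(3) by (auto simp: pegs_def)
  show ?thesis
    unfolding hanoi_cost_def min_cost_def
  proof (rule Least_equality)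
    show "transfer w n (perfect n ?i) (tower_cost \<alpha> n) (perfect n ?j)"
      by (rule transfer_tower_cost[OF assms(1) ij])
    show "tower_cost \<alpha> n \<le> c" if "transfer w n (perfect n ?i) c (perfect n ?j)" for c
      by (rule tower_cost_le[OF assms(1,2) that ij])
  qed
qed

lemma tower_cost_fib:
  "tower_cost (\<lambda>n. real (fib (n + 1))) n = 2 ^ (n + 1) - real (fib (n + 3))"
  by (induction n) (simp_all add: numeral_3_eq_3)

theorem proposition7:
  fixes w :: "nat \<Rightarrow> nat \<Rightarrow> real" and t :: "nat \<Rightarrow> real"
  assumes "\<And>n k. k \<in> pegs \<Longrightarrow> w n k = real (fib (n + 1))"
    and "\<And>n. t n = hanoi_cost w n 0"
  shows "(\<forall>n. \<forall>k\<in>pegs. hanoi_cost w n k = t n) \<and>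
         (\<forall>n. t n = 2 ^ (n + 1) - real (fib (n + 3))) \<and>
         t 0 = 0 \<and> t 1 = 1 \<and> t 2 = 3 \<and>
         (\<forall>n. t (n + 3) = 3 * t (n + 2) - t (n + 1) - 2 * t n)"
proof -
  have cost: "hanoi_cost w n k = 2 ^ (n + 1) - real (fib (n + 3))" if "k \<in> pegs" for n k
    unfolding tower_cost_fib[symmetric]
    by (rule hanoi_cost_peg_independent[OF assms(1) _ that]) simp_all
  then have t: "t n = 2 ^ (n + 1) - real (fib (n + 3))" for n
    by (simp add: assms(2) pegs_def)
  have "hanoi_cost w n k = t n" if "k \<in> pegs" for n k
    using cost[OF that] t by simp
  moreover have "t 0 = 0" "t 1 = 1" "t 2 = 3"
    by (simp_all add: t eval_nat_numeral)
  moreover have "t (n + 3) = 3 * t (n + 2) - t (n + 1) - 2 * t n" for n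
    by (simp add: t eval_nat_numeral)
  ultimately show ?thesis using t by blast
qed

end
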